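(* Let $G$ be a connected graph of order $n$ with minimum degree $\delta$, and let $trc(G)$ denote its total rainbow connection number. Then: (i) if $\delta\geq\sqrt{n-2}-1$ and $n\geq 291$, then $trc(G)\leq \frac{6n}{\delta+1}+28$; (ii) if $16\leq\delta\leq\sqrt{n-2}-2$, then $trc(G)\leq\frac{7n}{\delta+1}+32$; (iii) if $6\leq\delta\leq 15$, then $trc(G)\leq \frac{7n}{\delta+1}+4C(\delta)+12$, where $C(\delta)=e^{\frac{3\log(\delta^3+2\delta^2+3)-3(\log 3-1)}{\delta-3}}-2$.
   Context: All graphs are simple, finite and undirected; $\log$ denotes the natural logarithm. A total-colored graph is a graph in which every edge and every vertex is assigned a color. A path in a total-colored graph is a total rainbow path if its edges and its internal vertices all have pairwise distinct colors. A total-colored graph is total-rainbow connected if any two vertices are joined by a total rainbow path. For a connected graph $G$, the total rainbow connection number $trc(G)$ is the smallest number of colors in a total-coloring of $G$ that makes $G$ total-rainbow connected. *)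

theory Defs
  imports Complex_Main "Graph_Theory.Graph_Theory"
begin

text \<open>
  A finite simple undirected graph is an instance of the locale \<^locale>\<open>graph\<close>: a finite, symmetric
  digraph without loops and parallel arcs. An undirected edge is the two-element set of the ends
  of a pair of opposite arcs, so that both orientations of an edge carry the same color, and the
  degree of a vertex is its out-degree.
\<close>

definition undirected_edges :: "('a, 'b) pre_digraph \<Rightarrow> 'a set set" where
  "undirected_edges G = {{u, v} | u v. (u, v) \<in> arcs_ends G}"

definition min_degree :: "('a, 'b) pre_digraph \<Rightarrow> nat" where
  "min_degree G = Min (out_degree G ` verts G)"

definition path_edges :: "'a vwalk \<Rightarrow> 'a set list" where
  "path_edges p = map (\<lambda>(u, v). {u, v}) (vwalk_arcs p)"

definition internal_verts :: "'a vwalk \<Rightarrow> 'a list" where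
  "internal_verts p = butlast (tl p)"

text \<open>
  A total-coloring consists of a vertex coloring \<open>cv\<close> and an edge coloring \<open>ce\<close> with a common
  color set. It need not be proper.
\<close>

definition total_rainbow_path ::
  "('a, 'b) pre_digraph \<Rightarrow> ('a \<Rightarrow> nat) \<Rightarrow> ('a set \<Rightarrow> nat) \<Rightarrow> 'a vwalk \<Rightarrow> bool" where
  "total_rainbow_path G cv ce p \<longleftrightarrow>
     vpath p G \<and> distinct (map ce (path_edges p) @ map cv (internal_verts p))"

definition total_rainbow_connected ::
  "('a, 'b) pre_digraph \<Rightarrow> ('a \<Rightarrow> nat) \<Rightarrow> ('a set \<Rightarrow> nat) \<Rightarrow> bool" where
  "total_rainbow_connected G cv ce \<longleftrightarrow>
     (\<forall>u \<in> verts G. \<forall>v \<in> verts G. \<exists>p. total_rainbow_path G cv ce p \<and> hd p = u \<and> last p = v)"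

definition num_colors ::
  "('a, 'b) pre_digraph \<Rightarrow> ('a \<Rightarrow> nat) \<Rightarrow> ('a set \<Rightarrow> nat) \<Rightarrow> nat" where
  "num_colors G cv ce = card (cv ` verts G \<union> ce ` undirected_edges G)"

definition trc :: "('a, 'b) pre_digraph \<Rightarrow> nat" where
  "trc G = (LEAST k. \<exists>cv ce. total_rainbow_connected G cv ce \<and> num_colors G cv ce = k)"

definition C_bound :: "nat \<Rightarrow> real" where
  "C_bound \<delta> =
     exp ((3 * ln (real \<delta> ^ 3 + 2 * real \<delta> ^ 2 + 3) - 3 * (ln 3 - 1)) / (real \<delta> - 3)) - 2"

text \<open>The minimum defining \<^const>\<open>trc\<close> ranges over a nonempty set for every connected graph.\<close>

lemma set_path_edges_subset:
  assumes "vwalk p G"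
  shows "set (path_edges p) \<subseteq> undirected_edges G"
  using assms by (force simp: path_edges_def undirected_edges_def vwalk_def)

lemma path_edge_subset_verts: "e \<in> set (path_edges p) \<Longrightarrow> e \<subseteq> set p"
  by (induction p rule: vwalk_arcs.induct) (auto simp: path_edges_def)

lemma distinct_path_edges: "distinct p \<Longrightarrow> distinct (path_edges p)"
proof (induction p rule: vwalk_arcs.induct)
  case (3 x y xs)
  have "{x, y} \<notin> set (path_edges (y # xs))"
    using path_edge_subset_verts[of "{x, y}" "y # xs"] 3(2) by auto
  with 3 show ?case by (simp add: path_edges_def)
qed (simp_all add: path_edges_def)

lemma ex_total_rainbow_connected:
  assumes "graph G" and "Digraph_Component.connected G"
  shows "\<exists>cv ce. total_rainbow_connected G cv ce"
proof -
  interpret graph G by fact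
  have fin: "finite (undirected_edges G)"
  proof -
    have "undirected_edges G = (\<lambda>(u, v). {u, v}) ` arcs_ends G"
      by (auto simp: undirected_edges_def)
    then show ?thesis by (simp add: arcs_ends_def)
  qed
  obtain f :: "'a \<Rightarrow> nat" where f: "inj_on f (verts G)"
    using finite_imp_inj_to_nat_seg[OF finite_verts] by metis
  obtain g :: "'a set \<Rightarrow> nat" where g: "inj_on g (undirected_edges G)"
    using finite_imp_inj_to_nat_seg[OF fin] by metis
  let ?cv = "\<lambda>v. 2 * f v" and ?ce = "\<lambda>e. 2 * g e + 1"
  have "\<exists>p. total_rainbow_path G ?cv ?ce p \<and> hd p = u \<and> last p = v"
    if "u \<in> verts G" "v \<in> verts G" for u v
  proof -
    have "u \<rightarrow>\<^sup>*\<^bsub>G\<^esub> v"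
      using assms(2) that reachable_mk_symmetric_eq[OF sym_arcs]
      by (auto simp: Digraph_Component.connected_def strongly_connected_def)
    then obtain p where p: "vpath p G" "hd p = u" "last p = v"
      by (auto simp: reachable_vpath_conv)
    have "inj_on ?ce (set (path_edges p))"
      using g set_path_edges_subset[of p G] p(1) by (auto simp: inj_on_def vpath_def subset_iff)
    moreover have int: "set (internal_verts p) \<subseteq> set p"
      by (cases p) (auto simp: internal_verts_def dest: in_set_butlastD)
    moreover have "inj_on ?cv (set (internal_verts p))"
      using f int p(1) by (auto simp: inj_on_def vpath_def vwalk_def subset_iff)
    moreover have "distinct (internal_verts p)"
      using p(1) by (auto simp: internal_verts_def vpath_def distinct_butlast distinct_tl)
    moreover have "2 * g e + 1 \<noteq> 2 * f w" for e w by presburger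
    ultimately have "total_rainbow_path G ?cv ?ce p"
      using p(1) distinct_path_edges[of p]
      by (auto simp: total_rainbow_path_def distinct_map vpath_def)
    with p show ?thesis by blast
  qed
  then show ?thesis unfolding total_rainbow_connected_def by blast
qed

end

theory Submission
  imports Defs
begin

text \<open>
  Grow a subtree \<open>D\<close> greedily, adding at most three vertices for every \<open>\<delta>\<close> + 1 vertices that enter its
  closed neighborhood; it ends with at most 3n/(\<open>\<delta>\<close> + 1) vertices, and all other vertices are within
  distance two. Its vertices and edges get pairwise distinct colors. Let \<open>L\<close> be the set of vertices at
  distance one. By maximality every vertex at distance two has more than (\<open>\<delta>\<close> + 1)/3 neighbors in \<open>L\<close>,
  while every vertex of \<open>L\<close> has at most \<open>\<delta>\<close>/3 neighbors at distance two. This imbalance replaces the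
  Lovasz Local Lemma: linear algebra yields a 2-coloring of \<open>L\<close> in which every vertex at distance two
  sees both colors. Together with a second 2-coloring, for the edges inside \<open>L\<close>, it splits \<open>L\<close> into four
  classes such that any two vertices can enter the tree by routes with disjoint color sets. Thirteen
  colors suffice outside the tree, so all three bounds follow from trc(G) \<open>\<le>\<close> 6n/(\<open>\<delta>\<close> + 1) + 12.
\<close>

subsection \<open>Two-colorings of sparse hypergraphs\<close>

text \<open>Gaussian elimination, one equation per induction step: an equation with a nonzero
  coefficient at \<open>v0\<close> is solved for that unknown and substituted into the
  others.\<close>

lemma ex_null_vector:
  fixes a :: "'e \<Rightarrow> 'v \<Rightarrow> real"
  assumes "finite E" "finite V" "card E < card V"
  shows "\<exists>x. (\<exists>v\<in>V. x v \<noteq> 0) \<and> (\<forall>e\<in>E. (\<Sum>v\<in>V. a e v * x v) = 0)"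
  using assms
proof (induction E arbitrary: V a rule: finite_induct)
  case empty
  then have "V \<noteq> {}" by auto
  then show ?case by (intro exI[of _ "\<lambda>_. 1"]) auto
next
  case (insert e E)
  show ?case
  proof (cases "\<forall>v\<in>V. a e v = 0")
    case True
    from insert have "\<exists>x. (\<exists>v\<in>V. x v \<noteq> 0) \<and> (\<forall>e\<in>E. (\<Sum>v\<in>V. a e v * x v) = 0)"
      by (intro insert.IH) auto
    with True show ?thesis by auto
  next
    case False
    then obtain v0 where v0: "v0 \<in> V" "a e v0 \<noteq> 0" by blast
    define W where "W = V - {v0}"
    have W: "finite W" "V = insert v0 W" "v0 \<notin> W"
      using insert.prems v0 by (auto simp: W_def)
    then have "card E < card W" using insert by simp
    \<comment> \<open>These are the coefficients left in equation \<open>f\<close> once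
      \<open>e\<close> has been used to eliminate \<open>v0\<close>.\<close>
    from insert.IH[OF \<open>finite W\<close> this, of "\<lambda>f v. a f v - a f v0 * a e v / a e v0"]
    obtain x where x: "\<exists>v\<in>W. x v \<noteq> 0"
      "\<And>f. f \<in> E \<Longrightarrow> (\<Sum>v\<in>W. (a f v - a f v0 * a e v / a e v0) * x v) = 0"
      by blast
    define s where "s = (\<Sum>v\<in>W. a e v * x v)"
    define y where "y = x(v0 := - s / a e v0)"
    have y: "(\<Sum>v\<in>V. a f v * y v) = a f v0 * (- s / a e v0) + (\<Sum>v\<in>W. a f v * x v)" for f
    proof -
      have "(\<Sum>v\<in>W. a f v * y v) = (\<Sum>v\<in>W. a f v * x v)"
        using W(3) by (intro sum.cong) (auto simp: y_def)
      then show ?thesis using W by (simp add: y_def)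
    qed
    have "(\<Sum>v\<in>V. a e v * y v) = 0"
      using v0 by (simp add: y s_def)
    moreover have "(\<Sum>v\<in>V. a f v * y v) = 0" if "f \<in> E" for f
    proof -
      have "0 = (\<Sum>v\<in>W. a f v * x v - (a f v0 / a e v0) * (a e v * x v))"
        using x(2)[OF that] by (simp add: algebra_simps)
      also have "\<dots> = (\<Sum>v\<in>W. a f v * x v) - (a f v0 / a e v0) * s"
        by (simp add: sum_subtractf s_def sum_distrib_left)
      finally show ?thesis unfolding y by simp
    qed
    moreover have "\<exists>v\<in>V. y v \<noteq> 0" using x(1) W by (auto simp: y_def)
    ultimately show ?thesis by (intro exI[of _ y]) auto
  qed
qed

text \<open>
  Double counting gives fewer hyperedges than vertices, so there is a nonzero weighting of the
  vertices under which every hyperedge has total weight zero. Vertices of nonzero weight are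
  colored by sign; hyperedges of weight identically zero are handled by induction.
\<close>

lemma ex_two_coloring:
  fixes H :: "'e \<Rightarrow> 'v set"
  assumes "finite V" "finite E"
    and "\<And>e. e \<in> E \<Longrightarrow> H e \<subseteq> V"
    and "\<And>e. e \<in> E \<Longrightarrow> t < card (H e)"
    and "\<And>v. v \<in> V \<Longrightarrow> card {e \<in> E. v \<in> H e} \<le> t"
  shows "\<exists>c :: 'v \<Rightarrow> bool. \<forall>e\<in>E. \<exists>v\<in>H e. \<exists>w\<in>H e. c v \<noteq> c w"
  using assms
proof (induction V arbitrary: E rule: finite_psubset_induct)
  case (psubset V)
  show ?case
  proof (cases "V = {}")
    case True
    then have "E = {}" using psubset.prems by (metis card.empty equals0I not_less_zero subset_empty)
    then show ?thesis by simp
  next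
    case False
    \<comment> \<open>Double counting of incidences: hyperedges contribute at least
      \<open>Suc t\<close> each, vertices at most \<open>t\<close> each.\<close>
    have "card E * Suc t \<le> (\<Sum>e\<in>E. card (H e))"
      using sum_bounded_below[of E "Suc t" "\<lambda>e. card (H e)"] psubset.prems(3) by (simp add: Suc_le_eq)
    also have "\<dots> = (\<Sum>e\<in>E. \<Sum>v\<in>V. if v \<in> H e then 1 else 0)"
    proof (intro sum.cong refl)
      fix e assume "e \<in> E"
      then have "V \<inter> H e = H e" using psubset.prems(2) by auto
      then show "card (H e) = (\<Sum>v\<in>V. if v \<in> H e then 1 else 0)"
        using psubset.hyps by (simp add: sum.If_cases)
    qed
    also have "\<dots> = (\<Sum>v\<in>V. card {e \<in> E. v \<in> H e})"
      using psubset.prems(1) by (subst sum.swap) (simp add: sum.If_cases Collect_conj_eq)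
    also have "\<dots> \<le> card V * t"
      using sum_bounded_above[of V "\<lambda>v. card {e \<in> E. v \<in> H e}" t] psubset.prems(4) by simp
    also have "\<dots> < card V * Suc t" using False psubset.hyps by (simp add: card_gt_0_iff)
    finally have "card E < card V" by (simp del: mult_Suc_right)
    from ex_null_vector[OF psubset.prems(1) psubset.hyps this, of "\<lambda>e v. of_bool (v \<in> H e)"]
    obtain x :: "'v \<Rightarrow> real" where x: "\<exists>v\<in>V. x v \<noteq> 0"
      "\<And>e. e \<in> E \<Longrightarrow> (\<Sum>v\<in>V. of_bool (v \<in> H e) * x v) = 0" by blast
    have x0: "(\<Sum>v\<in>H e. x v) = 0" if "e \<in> E" for e
    proof -
      have "(\<Sum>v\<in>H e. x v) = (\<Sum>v\<in>H e. of_bool (v \<in> H e) * x v)" by simp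
      also have "\<dots> = (\<Sum>v\<in>V. of_bool (v \<in> H e) * x v)"
        using psubset.hyps psubset.prems(2)[OF that] by (intro sum.mono_neutral_left) auto
      finally show ?thesis using x(2) that by simp
    qed
    \<comment> \<open>Signs cannot split the hyperedges inside \<open>Z\<close>. Since
      \<open>x\<close> is not identically zero, \<open>Z\<close> is a proper subset of
      \<open>V\<close>, so induction colors it.\<close>
    define Z where "Z = {v \<in> V. x v = 0}"
    define E' where "E' = {e \<in> E. H e \<subseteq> Z}"
    have "Z \<subset> V" using x(1) by (auto simp: Z_def)
    moreover have "card {e \<in> E'. v \<in> H e} \<le> t" if "v \<in> Z" for v
    proof -
      have "card {e \<in> E'. v \<in> H e} \<le> card {e \<in> E. v \<in> H e}"
        using psubset.prems(1) by (intro card_mono) (auto simp: E'_def)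
      also have "\<dots> \<le> t" using that psubset.prems(4) by (simp add: Z_def)
      finally show ?thesis .
    qed
    ultimately have "\<exists>c :: 'v \<Rightarrow> bool. \<forall>e\<in>E'. \<exists>v\<in>H e. \<exists>w\<in>H e. c v \<noteq> c w"
      using psubset.prems by (intro psubset.IH) (auto simp: E'_def)
    then obtain c :: "'v \<Rightarrow> bool" where c: "\<And>e. e \<in> E' \<Longrightarrow> \<exists>v\<in>H e. \<exists>w\<in>H e. c v \<noteq> c w" by blast
    define c' where "c' v = (if x v = 0 then c v else x v > 0)" for v
    have "\<exists>v\<in>H e. \<exists>w\<in>H e. c' v \<noteq> c' w" if e: "e \<in> E" for e
    proof (cases "e \<in> E'")
      case True
      then have "H e \<subseteq> Z" by (simp add: E'_def)
      with c[OF True] show ?thesis by (fastforce simp: c'_def Z_def)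
    next
      case False
      \<comment> \<open>The weights on \<open>H e\<close> sum to zero and not all vanish, so both
        signs occur.\<close>
      then obtain v where v: "v \<in> H e" "x v \<noteq> 0"
        using e psubset.prems(2) by (auto simp: E'_def Z_def)
      have fin: "finite (H e)" using e psubset.prems(2) psubset.hyps finite_subset by blast
      have "\<exists>w\<in>H e. x w > 0"
      proof (rule ccontr)
        assume "\<not> ?thesis"
        then have "\<forall>w\<in>H e. - x w \<ge> 0" by (auto simp: not_less)
        then have "\<forall>w\<in>H e. - x w = 0"
          using x0[OF e] sum_nonneg_eq_0_iff[OF fin, of "\<lambda>w. - x w"] by (simp add: sum_negf)
        with v show False by auto
      qed
      moreover have "\<exists>w\<in>H e. x w < 0"
      proof (rule ccontr)
        assume "\<not> ?thesis"
        then have "\<forall>w\<in>H e. x w \<ge> 0" by (auto simp: not_less)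
        then have "\<forall>w\<in>H e. x w = 0"
          using x0[OF e] sum_nonneg_eq_0_iff[OF fin, of x] by simp
        with v show False by auto
      qed
      ultimately show ?thesis by (force simp: c'_def)
    qed
    then show ?thesis by blast
  qed
qed

subsection \<open>Trees with large neighborhoods\<close>

definition nbrs :: "('a, 'b) pre_digraph \<Rightarrow> 'a \<Rightarrow> 'a set" where
  "nbrs G v = {w. (v, w) \<in> arcs_ends G}"

definition closed_nbhd :: "('a, 'b) pre_digraph \<Rightarrow> 'a set \<Rightarrow> 'a set" where
  "closed_nbhd G D = D \<union> (\<Union>v\<in>D. nbrs G v)"

text \<open>Trees are generated by attaching leaves instead of being defined by acyclicity: rule
  induction gives the edge count and the paths inside \<open>D\<close>, and greedy growth is
  repeated use of \<open>leaf\<close>.\<close>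

inductive subtree :: "('a, 'b) pre_digraph \<Rightarrow> 'a set \<Rightarrow> 'a set set \<Rightarrow> bool" for G where
  single: "v \<in> verts G \<Longrightarrow> subtree G {v} {}"
| leaf: "subtree G D F \<Longrightarrow> d \<in> D \<Longrightarrow> (d, v) \<in> arcs_ends G \<Longrightarrow> v \<notin> D
    \<Longrightarrow> subtree G (insert v D) (insert {d, v} F)"

lemma path_edges_append:
  assumes "p \<noteq> []" "q \<noteq> []"
  shows "path_edges (p @ q) = path_edges p @ {last p, hd q} # path_edges q"
  using assms by (simp add: path_edges_def vwalk_arcs_append)

lemma set_path_edges_rev: "set (path_edges (rev p)) = set (path_edges p)"
  by (force simp: path_edges_def set_vwalk_arcs_rev image_iff)

context graph
begin

lemma arcs_ends_sym: "(u, v) \<in> arcs_ends G \<Longrightarrow> (v, u) \<in> arcs_ends G"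
  using sym_arcs unfolding symmetric_def by (rule symD)

lemma nbrs_sym: "w \<in> nbrs G v \<longleftrightarrow> v \<in> nbrs G w"
  unfolding nbrs_def using arcs_ends_sym by blast

lemma nbrs_subset_verts: "nbrs G v \<subseteq> verts G"
  by (auto simp: nbrs_def)

lemma finite_nbrs: "finite (nbrs G v)"
  by (rule finite_subset[OF nbrs_subset_verts finite_verts])

lemma not_in_nbrs: "v \<notin> nbrs G v"
  unfolding nbrs_def using adj_not_same by blast

lemma card_nbrs: "card (nbrs G v) = out_degree G v"
proof -
  have "nbrs G v = head G ` out_arcs G v"
    by (auto simp: nbrs_def arcs_ends_def arc_to_ends_def)
  moreover have "inj_on (head G) (out_arcs G v)"
    by (intro inj_onI no_multi_arcs) (auto simp: arc_to_ends_def)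
  ultimately show ?thesis by (simp add: card_image out_degree_def)
qed

lemma closed_nbhd_subset_verts: "D \<subseteq> verts G \<Longrightarrow> closed_nbhd G D \<subseteq> verts G"
  using nbrs_subset_verts by (auto simp: closed_nbhd_def)

lemma closed_nbhdD: "v \<in> closed_nbhd G D \<Longrightarrow> v \<notin> D \<Longrightarrow> \<exists>d\<in>D. d \<in> nbrs G v"
  unfolding closed_nbhd_def using nbrs_sym by blast

lemma subtree_props:
  assumes "subtree G D F"
  shows "D \<subseteq> verts G" "D \<noteq> {}" "finite F" "card D = Suc (card F)" "e \<in> F \<Longrightarrow> e \<subseteq> D"
proof -
  have "D \<subseteq> verts G \<and> D \<noteq> {} \<and> finite F \<and> card D = Suc (card F) \<and> (\<forall>e\<in>F. e \<subseteq> D)"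
    using assms
  proof induction
    case (leaf D F d v)
    \<comment> \<open>Edges of \<open>F\<close> lie inside \<open>D\<close>, which misses
      \<open>v\<close>; hence each leaf adds exactly one edge.\<close>
    then have "{d, v} \<notin> F" "finite D" using finite_subset by auto
    with leaf show ?case by auto
  qed auto
  then show "D \<subseteq> verts G" "D \<noteq> {}" "finite F" "card D = Suc (card F)" "e \<in> F \<Longrightarrow> e \<subseteq> D"
    by auto
qed

lemma subtree_path:
  assumes "subtree G D F" "u \<in> D" "v \<in> D"
  shows "\<exists>p. vpath p G \<and> hd p = u \<and> last p = v \<and> set p \<subseteq> D \<and> set (path_edges p) \<subseteq> F"
  using assms
proof (induction arbitrary: u v)
  case (single w)
  then show ?case by (intro exI[of _ "[w]"]) (auto simp: vpath_self path_edges_def)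
next
  case (leaf D F d w)
  \<comment> \<open>Only paths with the new leaf as an end are new: extend a path to
    \<open>d\<close> by \<open>w\<close>, and reverse it if it has to start at
    \<open>w\<close>.\<close>
  have to_w: "\<exists>p. vpath p G \<and> hd p = u \<and> last p = w \<and> set p \<subseteq> insert w D
      \<and> set (path_edges p) \<subseteq> insert {d, w} F" if "u \<in> D" for u
  proof -
    from leaf.IH[OF that \<open>d \<in> D\<close>] obtain p where p: "vpath p G" "hd p = u" "last p = d" "set p \<subseteq> D"
      "set (path_edges p) \<subseteq> F" by blast
    have "p \<noteq> []" using p(1) by (auto simp: vpath_def vwalk_def)
    have "vpath (p @ [w]) G"
      using p leaf \<open>p \<noteq> []\<close> by (auto simp: vpath_def vwalk_def set_vwalk_arcs_snoc)
    moreover have "set (path_edges (p @ [w])) \<subseteq> insert {d, w} F"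
      using p \<open>p \<noteq> []\<close> path_edges_append[of p "[w]"] by (auto simp: path_edges_def)
    ultimately show ?thesis using p \<open>p \<noteq> []\<close> by (intro exI[of _ "p @ [w]"]) auto
  qed
  have w: "w \<in> verts G" using leaf by auto
  consider "u \<in> D" "v \<in> D" | "u \<in> D" "v = w" | "u = w" "v \<in> D" | "u = w" "v = w"
    using leaf.prems by blast
  then show ?case
  proof cases
    case 1
    with leaf.IH show ?thesis by blast
  next
    case 2
    with to_w show ?thesis by blast
  next
    case 3
    from to_w[OF 3(2)] obtain p where p: "vpath p G" "hd p = v" "last p = w" "set p \<subseteq> insert w D"
      "set (path_edges p) \<subseteq> insert {d, w} F" by blast
    have "vpath (rev p) G"
      using p(1) by (auto simp: vpath_def vwalk_def set_vwalk_arcs_rev intro: arcs_ends_sym)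
    moreover have "p \<noteq> []" using p(1) by (auto simp: vpath_def vwalk_def)
    ultimately show ?thesis using p 3
      by (intro exI[of _ "rev p"]) (auto simp: set_path_edges_rev hd_rev last_rev)
  next
    case 4
    with w show ?thesis by (intro exI[of _ "[w]"]) (auto simp: vpath_self path_edges_def)
  qed
qed

lemma closed_nbhd_mono: "D \<subseteq> D' \<Longrightarrow> closed_nbhd G D \<subseteq> closed_nbhd G D'"
  by (auto simp: closed_nbhd_def)

text \<open>Without such an arc, \<open>A\<close> would contain everything reachable from
  it.\<close>

lemma connected_crossing_arc:
  assumes "Digraph_Component.connected G" "A \<subseteq> verts G" "A \<noteq> {}" "A \<noteq> verts G"
  shows "\<exists>a\<in>A. \<exists>b\<in>verts G - A. (a, b) \<in> arcs_ends G"
proof (rule ccontr)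
  assume no: "\<not> ?thesis"
  from assms obtain x y where xy: "x \<in> A" "y \<in> verts G" "y \<notin> A" by blast
  then have "x \<rightarrow>\<^sup>* y"
    using assms(1,2) reachable_mk_symmetric_eq[OF sym_arcs]
    by (auto simp: Digraph_Component.connected_def strongly_connected_def)
  then have "y \<in> A"
  proof (induction rule: reachable_induct)
    case (step u v)
    then show ?case using no adj_in_verts(2) by blast
  qed (use xy in auto)
  with xy show False by simp
qed

text \<open>
  Among all subtrees with at most 3/(\<open>\<delta>\<close> + 1) vertices per vertex of their closed neighborhood, one
  whose closed neighborhood is largest cannot be extended: neither by a path of three vertices
  ending at distance three, nor by a path of two vertices ending at distance two, nor by a single
  adjacent vertex.
\<close>

lemma ex_dominating_subtree:
  assumes conn: "Digraph_Component.connected G"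
    and deg: "\<And>v. v \<in> verts G \<Longrightarrow> \<delta> \<le> card (nbrs G v)"
  shows "\<exists>D F. subtree G D F \<and> Suc \<delta> * card D \<le> 3 * card (verts G)
    \<and> (\<forall>u\<in>verts G - closed_nbhd G D. Suc \<delta> < 3 * card (nbrs G u \<inter> (closed_nbhd G D - D)))
    \<and> (\<forall>y\<in>closed_nbhd G D - D. 3 * card (nbrs G y - closed_nbhd G D) \<le> \<delta>)"
proof -
  let ?N = "closed_nbhd G"
  define P where "P = (\<lambda>(D, F). subtree G D F \<and> Suc \<delta> * card D \<le> 3 * card (?N D))"
  have card_insert_nbrs: "Suc \<delta> \<le> card (insert v (nbrs G v))" if "v \<in> verts G" for v
    using deg[OF that] finite_nbrs not_in_nbrs by simp
  have card_N: "card (?N D) \<le> card (verts G)" if "subtree G D F" for D F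
    using subtree_props(1)[OF that] closed_nbhd_subset_verts by (simp add: card_mono)
  obtain v where v: "v \<in> verts G"
    using conn by (auto simp: Digraph_Component.connected_def strongly_connected_def)
  have "?N {v} = insert v (nbrs G v)" by (simp add: closed_nbhd_def)
  \<comment> \<open>A single vertex already dominates at least \<open>Suc \<delta>\<close> vertices,
    so the family is nonempty.\<close>
  then have "P ({v}, {})" using v card_insert_nbrs[OF v] by (simp add: P_def subtree.single)
  moreover have "\<forall>T. P T \<longrightarrow> card (?N (fst T)) < Suc (card (verts G))"
    using card_N by (auto simp: P_def less_Suc_eq_le)
  ultimately obtain T where "P T" and T: "\<And>T'. P T' \<Longrightarrow> card (?N (fst T')) \<le> card (?N (fst T))"
    using ex_has_greatest_nat[of P _ "\<lambda>T. card (?N (fst T))"] by blast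
  then obtain D F where DF: "subtree G D F" "Suc \<delta> * card D \<le> 3 * card (?N D)"
    and max: "\<And>D' F'. P (D', F') \<Longrightarrow> card (?N D') \<le> card (?N D)"
    by (cases T) (force simp: P_def)
  note D = subtree_props[OF DF(1)]
  have finN: "finite (?N D')" if "subtree G D' F'" for D' F'
    using subtree_props(1)[OF that] closed_nbhd_subset_verts finite_verts finite_subset by metis
  \<comment> \<open>Common end of the three extension arguments: if newly dominated vertices
    \<open>X\<close> pay for the added vertices at the allowed rate, the larger tree contradicts
    maximality.\<close>
  have grow: False if T': "subtree G D' F'" and "D \<subseteq> D'" and le: "Suc \<delta> * card (D' - D) \<le> 3 * card X"
    and X: "X \<subseteq> ?N D' - ?N D" "X \<noteq> {}" for D' F' X
  proof -
    have fin: "finite D'" "finite X" "finite (?N D)"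
      using subtree_props(1)[OF T'] finite_subset[OF _ finite_verts] finN[OF T'] finN[OF DF(1)] X(1)
        finite_subset[of X] by auto
    have "card (?N D) + card X = card (?N D \<union> X)"
      using fin X by (intro card_Un_disjoint[symmetric]) auto
    also have "\<dots> \<le> card (?N D')"
      using finN[OF T'] closed_nbhd_mono[OF \<open>D \<subseteq> D'\<close>] X by (intro card_mono) auto
    finally have N: "card (?N D) + card X \<le> card (?N D')" .
    have "card D' = card D + card (D' - D)"
      using fin \<open>D \<subseteq> D'\<close> by (metis card_Diff_subset card_mono finite_subset le_add_diff_inverse)
    then have "Suc \<delta> * card D' = Suc \<delta> * card D + Suc \<delta> * card (D' - D)"
      by (simp add: algebra_simps)
    also have "\<dots> \<le> 3 * card (?N D')" using N DF(2) le by linarith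
    finally have "card (?N D') \<le> card (?N D)" using T' by (intro max) (simp add: P_def)
    moreover have "card X > 0" using fin X by (simp add: card_gt_0_iff)
    ultimately show False using N by simp
  qed
  have out: "nbrs G u \<inter> D = {}" if "u \<notin> ?N D" for u
    using that nbrs_sym unfolding closed_nbhd_def by blast
  have NN: "?N (?N D) = verts G"
  proof (rule ccontr)
    assume "\<not> ?thesis"
    moreover have "?N (?N D) \<subseteq> verts G" by (intro closed_nbhd_subset_verts D)
    moreover have "?N (?N D) \<noteq> {}" using D(2) by (simp add: closed_nbhd_def)
    ultimately obtain a b where ab: "a \<in> ?N (?N D)" "b \<in> verts G" "b \<notin> ?N (?N D)" "b \<in> nbrs G a"
      using connected_crossing_arc[OF conn, of "?N (?N D)"] by (auto simp: nbrs_def)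
    then have a: "a \<notin> ?N D" by (auto simp: closed_nbhd_def)
    then obtain y where y: "y \<in> ?N D" "a \<in> nbrs G y"
      using closed_nbhdD[OF ab(1)] nbrs_sym by blast
    then have "y \<notin> D" using a by (auto simp: closed_nbhd_def)
    then obtain d where d: "d \<in> D" "y \<in> nbrs G d" using closed_nbhdD[OF y(1)] nbrs_sym by blast
    have b: "b \<notin> ?N D" "b \<noteq> a" "b \<noteq> y" "b \<notin> D" using ab y by (auto simp: closed_nbhd_def)
    have "a \<notin> D" "a \<noteq> y" using a y by (auto simp: closed_nbhd_def)
    \<comment> \<open>Here \<open>b\<close> is at distance three, so its whole closed neighborhood,
      at least \<open>Suc \<delta>\<close> vertices, is new and pays for three vertices.\<close>
    let ?D' = "insert b (insert a (insert y D))"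
    have "subtree G ?D' (insert {a, b} (insert {y, a} (insert {d, y} F)))"
      using DF(1) d y ab b \<open>y \<notin> D\<close> \<open>a \<notin> D\<close> \<open>a \<noteq> y\<close>
      by (intro subtree.leaf) (auto simp: nbrs_def)
    moreover have "card (?D' - D) \<le> card {b, a, y}" by (intro card_mono) auto
    then have "card (?D' - D) \<le> 3" by (auto simp: card_insert_if split: if_splits)
    then have "Suc \<delta> * card (?D' - D) \<le> 3 * card (insert b (nbrs G b))"
      using mult_le_mono[OF card_insert_nbrs[OF ab(2)], of "card (?D' - D)" 3]
      by (simp only: mult.commute[of 3])
    moreover have "insert b (nbrs G b) \<subseteq> ?N ?D' - ?N D"
      using ab(3) b nbrs_sym unfolding closed_nbhd_def by blast
    ultimately show False by (intro grow[of ?D' _ "insert b (nbrs G b)"]) auto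
  qed
  have "Suc \<delta> < 3 * card (nbrs G u \<inter> (?N D - D))" if u: "u \<in> verts G" "u \<notin> ?N D" for u
  proof (rule ccontr)
    assume small: "\<not> ?thesis"
    from u NN have "u \<in> ?N (?N D)" by simp
    then obtain y where y: "y \<in> ?N D" "u \<in> nbrs G y"
      using closed_nbhdD[OF _ u(2)] nbrs_sym by blast
    then have "y \<notin> D" using u by (auto simp: closed_nbhd_def)
    then obtain d where d: "d \<in> D" "y \<in> nbrs G d" using closed_nbhdD[OF y(1)] nbrs_sym by blast
    have "u \<notin> D" "u \<noteq> y" using u y by (auto simp: closed_nbhd_def)
    \<comment> \<open>If at most a third of \<open>Suc \<delta>\<close> neighbors of
      \<open>u\<close> lie at distance one, then \<open>u\<close> and its remaining neighbors number
      at least two thirds of \<open>Suc \<delta>\<close>, which pays for two vertices.\<close>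
    let ?D' = "insert u (insert y D)" and ?X = "insert u (nbrs G u - ?N D)"
    have "subtree G ?D' (insert {y, u} (insert {d, y} F))"
      using DF(1) d y \<open>y \<notin> D\<close> \<open>u \<notin> D\<close> \<open>u \<noteq> y\<close> by (intro subtree.leaf) (auto simp: nbrs_def)
    moreover have "Suc \<delta> * card (?D' - D) \<le> 3 * card ?X"
    proof -
      have "card (?D' - D) \<le> card {u, y}" by (intro card_mono) auto
      then have "card (?D' - D) \<le> 2" by (auto simp: card_insert_if split: if_splits)
      then have le: "Suc \<delta> * card (?D' - D) \<le> 2 * Suc \<delta>"
        by (metis mult.commute mult_le_mono2)
      have "nbrs G u = (nbrs G u \<inter> (?N D - D)) \<union> (nbrs G u - ?N D)" using out[OF u(2)] by auto
      then have "card (nbrs G u) \<le> card (nbrs G u \<inter> (?N D - D)) + card (nbrs G u - ?N D)"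
        by (metis card_Un_le)
      moreover have "card ?X = Suc (card (nbrs G u - ?N D))"
        using finite_nbrs not_in_nbrs by simp
      ultimately have "2 * Suc \<delta> \<le> 3 * card ?X" using small deg[OF u(1)] by arith
      with le show ?thesis by (rule order_trans)
    qed
    moreover have "?X \<subseteq> ?N ?D' - ?N D" using u by (auto simp: closed_nbhd_def)
    ultimately show False by (intro grow[of ?D' _ ?X]) auto
  qed
  moreover have "3 * card (nbrs G y - ?N D) \<le> \<delta>" if y: "y \<in> ?N D" "y \<notin> D" for y
  proof (rule ccontr)
    assume large: "\<not> ?thesis"
    obtain d where d: "d \<in> D" "y \<in> nbrs G d" using closed_nbhdD[OF y] nbrs_sym by blast
    \<comment> \<open>More than \<delta>/3 new neighbors means at least (\<delta> + 1)/3, which pays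
      for the single vertex \<open>y\<close>.\<close>
    have "subtree G (insert y D) (insert {d, y} F)"
      using DF(1) d y by (intro subtree.leaf) (auto simp: nbrs_def)
    moreover have "insert y D - D = {y}" using y by auto
    then have "Suc \<delta> * card (insert y D - D) \<le> 3 * card (nbrs G y - ?N D)"
      using large by simp
    moreover have "nbrs G y - ?N D \<subseteq> ?N (insert y D) - ?N D" by (auto simp: closed_nbhd_def)
    moreover have "nbrs G y - ?N D \<noteq> {}" using large by (metis card.empty le0 mult_0_right)
    ultimately show False by (intro grow[of "insert y D" _ "nbrs G y - ?N D"]) auto
  qed
  moreover have "Suc \<delta> * card D \<le> 3 * card (verts G)"
    using DF(2) card_N[OF DF(1)] by linarith
  ultimately show ?thesis using DF(1) by blast
qed

subsection \<open>Coloring the neighborhood of the tree\<close>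

text \<open>
  One of the two bits of a class makes the vertices outside the closed neighborhood see two
  classes; the other is membership in a maximal independent set of the neighborhood.
\<close>

lemma ex_classes:
  fixes D :: "'a set"
  defines "L \<equiv> closed_nbhd G D - D"
  assumes D: "D \<subseteq> verts G" and "2 \<le> \<delta>"
    and deg: "\<And>v. v \<in> verts G \<Longrightarrow> \<delta> \<le> card (nbrs G v)"
    and far: "\<And>u. u \<in> verts G - closed_nbhd G D \<Longrightarrow> Suc \<delta> < 3 * card (nbrs G u \<inter> L)"
    and near: "\<And>y. y \<in> L \<Longrightarrow> 3 * card (nbrs G y - closed_nbhd G D) \<le> \<delta>"
  shows "\<exists>cl :: 'a \<Rightarrow> nat. (\<forall>v. cl v < 4)
    \<and> (\<forall>u\<in>verts G - closed_nbhd G D. \<exists>y\<in>nbrs G u \<inter> L. \<exists>z\<in>nbrs G u \<inter> L. cl y \<noteq> cl z)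
    \<and> (\<forall>y\<in>L. (\<exists>z\<in>nbrs G y \<inter> L. cl z \<noteq> cl y) \<or> (\<exists>d\<in>nbrs G y \<inter> D. \<exists>d'\<in>nbrs G y \<inter> D. d \<noteq> d'))"
proof -
  have L: "L \<subseteq> verts G" using D closed_nbhd_subset_verts by (auto simp: L_def)
  have "\<exists>c :: 'a \<Rightarrow> bool. \<forall>u\<in>verts G - closed_nbhd G D. \<exists>v\<in>nbrs G u \<inter> L. \<exists>w\<in>nbrs G u \<inter> L. c v \<noteq> c w"
  \<comment> \<open>Hypergraph on \<open>L\<close> whose hyperedges are the neighborhoods in
    \<open>L\<close> of the vertices at distance two; the threshold is
    \<open>\<delta> div 3\<close>.\<close>
  proof (rule ex_two_coloring)
    show "finite L" by (rule finite_subset[OF L finite_verts])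
    fix u assume "u \<in> verts G - closed_nbhd G D"
    from far[OF this] show "\<delta> div 3 < card (nbrs G u \<inter> L)" by linarith
  next
    fix y assume "y \<in> L"
    then have "{u \<in> verts G - closed_nbhd G D. y \<in> nbrs G u \<inter> L} = nbrs G y - closed_nbhd G D"
    proof (intro set_eqI)
      fix u
      show "u \<in> {u \<in> verts G - closed_nbhd G D. y \<in> nbrs G u \<inter> L} \<longleftrightarrow> u \<in> nbrs G y - closed_nbhd G D"
        using nbrs_sym[of u y] nbrs_subset_verts[of y] \<open>y \<in> L\<close> by auto
    qed
    then show "card {u \<in> verts G - closed_nbhd G D. y \<in> nbrs G u \<inter> L} \<le> \<delta> div 3"
      using near[OF \<open>y \<in> L\<close>] by simp
  qed auto
  then obtain c :: "'a \<Rightarrow> bool" where c: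
    "\<forall>u\<in>verts G - closed_nbhd G D. \<exists>v\<in>nbrs G u \<inter> L. \<exists>w\<in>nbrs G u \<inter> L. c v \<noteq> c w" by blast
  define indep where "indep = {I. I \<subseteq> L \<and> (\<forall>x\<in>I. nbrs G x \<inter> I = {})}"
  have "finite indep" using finite_subset[OF L finite_verts] by (simp add: indep_def)
  moreover have "indep \<noteq> {}" by (auto simp: indep_def)
  ultimately obtain I where I: "I \<in> indep" "\<And>J. J \<in> indep \<Longrightarrow> I \<subseteq> J \<Longrightarrow> I = J"
    using finite_has_maximal[of indep] by metis
  have I': "\<exists>x\<in>nbrs G y. x \<in> I" if "y \<in> L" "y \<notin> I" for y
  proof (rule ccontr)
    assume "\<not> ?thesis"
    then have "x \<notin> nbrs G y" "y \<notin> nbrs G x" if "x \<in> I" for x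
      using that nbrs_sym[of x y] by auto
    then have "insert y I \<in> indep"
      using I(1) \<open>y \<in> L\<close> not_in_nbrs[of y] by (auto simp: indep_def)
    with I(2)[OF this] that show False by auto
  qed
  define cl :: "'a \<Rightarrow> nat" where "cl v = of_bool (c v) + 2 * of_bool (v \<in> I)" for v
  have cl_c: "cl y \<noteq> cl z" if "c y \<noteq> c z" for y z
    using that by (auto simp: cl_def)
  have cl_I: "cl y \<noteq> cl z" if "(y \<in> I) \<noteq> (z \<in> I)" for y z
    using that by (auto simp: cl_def)
  have "\<exists>z\<in>nbrs G y \<inter> L. cl z \<noteq> cl y"
    if y: "y \<in> L" "\<not> (\<exists>d\<in>nbrs G y \<inter> D. \<exists>d'\<in>nbrs G y \<inter> D. d \<noteq> d')" for y
  proof -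
    \<comment> \<open>At most one neighbor in the tree and at most \<delta>/3 at distance two leave
      a neighbor in \<open>L\<close>, as \<delta> is at least 2.\<close>
    have "card (nbrs G y \<inter> D) \<le> 1"
      using y(2) finite_nbrs by (subst One_nat_def, subst card_le_Suc0_iff_eq) auto
    moreover have "\<delta> \<le> card (nbrs G y)" using y(1) L deg by auto
    moreover have "nbrs G y = (nbrs G y \<inter> D) \<union> (nbrs G y \<inter> L) \<union> (nbrs G y - closed_nbhd G D)"
      by (auto simp: L_def closed_nbhd_def)
    then have "card (nbrs G y) \<le> card (nbrs G y \<inter> D) + card (nbrs G y \<inter> L)
        + card (nbrs G y - closed_nbhd G D)"
      by (metis add_le_mono1 card_Un_le le_trans)
    ultimately have "card (nbrs G y \<inter> L) \<noteq> 0" using near[OF y(1)] \<open>2 \<le> \<delta>\<close> by linarith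
    then have "nbrs G y \<inter> L \<noteq> {}" by auto
    then obtain z where z: "z \<in> nbrs G y \<inter> L" by blast
    show ?thesis
    \<comment> \<open>By independence a neighbor of a member of \<open>I\<close> is outside
      \<open>I\<close>; by maximality a non-member has a neighbor in \<open>I\<close>. Either way
      the second bit differs.\<close>
    proof (cases "y \<in> I")
      case True
      then have "z \<notin> I" using I(1) z by (auto simp: indep_def)
      with True z cl_I show ?thesis by blast
    next
      case False
      with I'[OF y(1)] obtain x where "x \<in> nbrs G y" "x \<in> I" by blast
      moreover have "x \<in> L" using I(1) \<open>x \<in> I\<close> by (auto simp: indep_def)
      ultimately show ?thesis using False cl_I by blast
    qed
  qed
  moreover have "cl v < 4" for v by (simp add: cl_def)
  moreover have "\<exists>y\<in>nbrs G u \<inter> L. \<exists>z\<in>nbrs G u \<inter> L. cl y \<noteq> cl z"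
    if "u \<in> verts G - closed_nbhd G D" for u
    using bspec[OF c that] cl_c by blast
  ultimately show ?thesis by (intro exI[of _ cl]) blast
qed

end

subsection \<open>The total-coloring\<close>

definition enumeration :: "'a set \<Rightarrow> 'a \<Rightarrow> nat" where
  "enumeration A = (SOME f. bij_betw f A {..<card A})"

lemma bij_betw_enumeration:
  assumes "finite A"
  shows "bij_betw (enumeration A) A {..<card A}"
  unfolding enumeration_def
  using someI_ex[OF ex_bij_betw_finite_nat[OF assms]] by (simp add: atLeast0LessThan)

text \<open>Tagging vertices and edges by \<open>Inl\<close> and \<open>Inr\<close> turns the
  rainbow condition into one injectivity statement, which can be assembled from disjoint blocks of
  colors.\<close>

lemma total_rainbow_pathI:
  assumes "vpath p G" "inj_on (case_sum cv ce) A"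
    and "Inl ` set (internal_verts p) \<union> Inr ` set (path_edges p) \<subseteq> A"
  shows "total_rainbow_path G cv ce p"
proof -
  have inj: "inj_on (case_sum cv ce) (Inl ` set (internal_verts p) \<union> Inr ` set (path_edges p))"
    using assms(2,3) by (rule inj_on_subset)
  have "distinct p" using assms(1) by (auto simp: vpath_def)
  then have "distinct (path_edges p)" "distinct (internal_verts p)"
    by (simp_all add: distinct_path_edges internal_verts_def distinct_butlast distinct_tl)
  moreover have "inj_on ce (set (path_edges p))"
  proof (rule inj_onI)
    fix e f assume "e \<in> set (path_edges p)" "f \<in> set (path_edges p)" "ce e = ce f"
    then show "e = f" using inj_onD[OF inj, of "Inr e" "Inr f"] by simp
  qed
  moreover have "inj_on cv (set (internal_verts p))"
  proof (rule inj_onI)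
    fix v w assume "v \<in> set (internal_verts p)" "w \<in> set (internal_verts p)" "cv v = cv w"
    then show "v = w" using inj_onD[OF inj, of "Inl v" "Inl w"] by simp
  qed
  moreover have "ce e \<noteq> cv v" if "e \<in> set (path_edges p)" "v \<in> set (internal_verts p)" for e v
    using that inj_onD[OF inj, of "Inr e" "Inl v"] by auto
  then have "ce ` set (path_edges p) \<inter> cv ` set (internal_verts p) = {}" by auto
  ultimately show ?thesis
    using assms(1) by (simp add: total_rainbow_path_def distinct_map)
qed

lemma inj_on_disjoint_Un:
  assumes "inj_on f A" "inj_on f B" "f ` A \<subseteq> K" "f ` B \<subseteq> K'" "K \<inter> K' = {}"
  shows "inj_on f (A \<union> B)"
  using assms by (fastforce simp: inj_on_Un)

lemma image_Inl_Inr_Un: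
  assumes "A \<subseteq> A1 \<union> A2 \<union> A3" "B \<subseteq> B1 \<union> B2 \<union> B3"
  shows "Inl ` A \<union> Inr ` B \<subseteq> Inl ` A1 \<union> Inr ` B1 \<union> (Inl ` A2 \<union> Inr ` B2) \<union> (Inl ` A3 \<union> Inr ` B3)"
  using assms by auto

lemma set_vwalk_arcs_join:
  assumes "t \<noteq> []"
  shows "set (vwalk_arcs (p @ t)) = set (vwalk_arcs (p @ [hd t])) \<union> set (vwalk_arcs t)"
  using assms by (cases "p = []") (auto simp: vwalk_arcs_append)

text \<open>The head of a nonempty \<open>p\<close> or \<open>q\<close> is an end of the whole path,
  so only the tails can be internal.\<close>

lemma set_internal_verts_append:
  assumes "t \<noteq> []"
  shows "set (internal_verts (p @ t @ rev q)) \<subseteq> set (tl p) \<union> set t \<union> set (tl q)"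
  using assms by (cases p; cases q; cases t) (auto simp: internal_verts_def butlast_append dest: in_set_butlastD)

text \<open>All that the coloring needs from the tree and the classes; the minimum degree enters
  only through these assumptions.\<close>

locale classified_subtree = graph G for G :: "('a, 'b) pre_digraph" +
  fixes D :: "'a set" and F :: "'a set set" and cl :: "'a \<Rightarrow> nat" and L :: "'a set"
  defines "L \<equiv> closed_nbhd G D - D"
  assumes tree: "subtree G D F"
    and cl_less: "cl v < 4"
    and far_classes: "u \<in> verts G - closed_nbhd G D \<Longrightarrow>
      \<exists>y\<in>nbrs G u \<inter> L. \<exists>z\<in>nbrs G u \<inter> L. cl y \<noteq> cl z"
    and near_classes: "y \<in> L \<Longrightarrow>
      (\<exists>z\<in>nbrs G y \<inter> L. cl z \<noteq> cl y) \<or> (\<exists>d\<in>nbrs G y \<inter> D. \<exists>d'\<in>nbrs G y \<inter> D. d \<noteq> d')"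
begin

text \<open>Among the edges from \<open>y\<close> into the tree, this one alone gets a color that
  depends on the class of \<open>y\<close>; the others offer a second entrance.\<close>

definition link :: "'a \<Rightarrow> 'a" where
  "link y = (SOME d. d \<in> nbrs G y \<inter> D)"

definition cv :: "'a \<Rightarrow> nat" where
  "cv v = (if v \<in> D then 13 + enumeration D v else cl v)"

text \<open>Palette: 0 to 3 for vertices outside the tree, 4 to 7 for link edges, 8 to 11 for edges
  from \<open>L\<close> to distance two, 12 for all remaining edges, and from 13 on the tree. In the
  class-dependent cases \<open>e\<close> has exactly one end in \<open>L\<close>, picked by
  \<open>the_elem\<close>.\<close>

definition ce :: "'a set \<Rightarrow> nat" where
  "ce e =
    (if e \<in> F then 13 + card D + enumeration F e
     else if \<exists>y\<in>L. e = {y, link y} then 4 + cl (the_elem (e \<inter> L))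
     else if e \<inter> L \<noteq> {} \<and> \<not> e \<subseteq> closed_nbhd G D then 8 + cl (the_elem (e \<inter> L))
     else 12)"

abbreviation col :: "'a + 'a set \<Rightarrow> nat" where
  "col \<equiv> case_sum cv ce"

text \<open>
  A route from \<open>x\<close> follows \<open>p\<close> outside the tree and then enters the tree at \<open>d\<close>, using the colors
  in \<open>K\<close> on its way. The vertex \<open>x\<close> is an end of the path, so its color is not counted.
\<close>

definition route :: "'a \<Rightarrow> nat set \<Rightarrow> 'a list \<Rightarrow> 'a \<Rightarrow> bool" where
  "route x K p d \<longleftrightarrow> vpath (p @ [d]) G \<and> hd (p @ [d]) = x \<and> d \<in> D \<and> set p \<inter> D = {}
    \<and> inj_on col (Inl ` set (tl p) \<union> Inr ` set (path_edges (p @ [d])))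
    \<and> col ` (Inl ` set (tl p) \<union> Inr ` set (path_edges (p @ [d]))) \<subseteq> K"

text \<open>The entry points may coincide. Tree colors start at 13, so the tree path between them
  cannot clash with either route.\<close>

definition joined :: "'a \<Rightarrow> 'a \<Rightarrow> bool" where
  "joined x y \<longleftrightarrow> (\<exists>K p d K' q e. route x K p d \<and> route y K' q e
    \<and> K \<inter> K' = {} \<and> K \<union> K' \<subseteq> {..<13} \<and> set p \<inter> set q = {})"

lemma joined_sym: "joined x y \<Longrightarrow> joined y x"
  unfolding joined_def by (metis inf_commute sup_commute)

section \<open>Colors of the edges and of the tree\<close>

lemmas tree_props = subtree_props[OF tree]

lemma finite_D: "finite D"
  using tree_props(1) finite_verts by (rule finite_subset)

lemma L_verts: "y \<in> L \<Longrightarrow> y \<in> verts G" and L_not_D: "y \<in> L \<Longrightarrow> y \<notin> D"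
  and L_nbhd: "y \<in> L \<Longrightarrow> y \<in> closed_nbhd G D"
  using closed_nbhd_subset_verts[OF tree_props(1)] by (auto simp: L_def)

lemma link: assumes "y \<in> L" shows "link y \<in> D" "link y \<in> nbrs G y"
proof -
  have "\<exists>d. d \<in> nbrs G y \<inter> D" using assms closed_nbhdD by (fastforce simp: L_def)
  then have "link y \<in> nbrs G y \<inter> D" unfolding link_def by (rule someI_ex)
  then show "link y \<in> D" "link y \<in> nbrs G y" by auto
qed

lemma not_in_F: "e \<inter> L \<noteq> {} \<Longrightarrow> e \<notin> F"
  using tree_props(5) L_not_D by blast

lemma ce_link:
  assumes "y \<in> L"
  shows "ce {y, link y} = 4 + cl y"
proof -
  have L: "{y, link y} \<inter> L = {y}" using assms link L_not_D by auto
  then have "{y, link y} \<notin> F" using not_in_F by auto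
  moreover have "\<exists>z\<in>L. {y, link y} = {z, link z}" using assms by blast
  ultimately have "ce {y, link y} = 4 + cl (the_elem ({y, link y} \<inter> L))"
    unfolding ce_def by (simp only: if_True if_False)
  then show ?thesis by (simp only: L the_elem_eq)
qed

lemma ce_not_link:
  assumes "y \<in> L" "d \<in> D" "d \<noteq> link y"
  shows "ce {y, d} = 12"
proof -
  have "{y, d} \<notin> F" using not_in_F[of "{y, d}"] assms by auto
  moreover have "d \<in> closed_nbhd G D" using assms by (simp add: closed_nbhd_def)
  ultimately show ?thesis using assms L_not_D L_nbhd link by (auto simp: ce_def doubleton_eq_iff)
qed

lemma ce_near:
  assumes "y \<in> L" "z \<in> L"
  shows "ce {y, z} = 12"
proof -
  have "{y, z} \<notin> F" using not_in_F[of "{y, z}"] assms by auto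
  then show ?thesis using assms L_not_D L_nbhd link by (auto simp: ce_def doubleton_eq_iff)
qed

lemma ce_far:
  assumes "u \<notin> closed_nbhd G D" "y \<in> L"
  shows "ce {u, y} = 8 + cl y"
proof -
  have "{u, y} \<notin> F" using not_in_F[of "{u, y}"] assms by auto
  moreover have "D \<subseteq> closed_nbhd G D" by (auto simp: closed_nbhd_def)
  then have "\<not> (\<exists>z\<in>L. {u, y} = {z, link z})"
    using assms L_nbhd link by (auto simp: doubleton_eq_iff)
  moreover have "{u, y} \<inter> L \<noteq> {} \<and> \<not> {u, y} \<subseteq> closed_nbhd G D" using assms by auto
  ultimately have "ce {u, y} = 8 + cl (the_elem ({u, y} \<inter> L))"
    unfolding ce_def by (simp only: if_True if_False simp_thms)
  moreover have "{u, y} \<inter> L = {y}" using assms L_nbhd by auto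
  ultimately show ?thesis by (simp only: the_elem_eq)
qed

lemma inj_on_tree: "inj_on col (Inl ` D \<union> Inr ` F)"
  and col_tree: "col ` (Inl ` D \<union> Inr ` F) \<subseteq> {13..}"
proof -
  have D: "inj_on (enumeration D) D" "\<And>v. v \<in> D \<Longrightarrow> enumeration D v < card D"
    and F: "inj_on (enumeration F) F"
    using bij_betw_enumeration[OF finite_D] bij_betw_enumeration[OF tree_props(3)]
    by (auto simp: bij_betw_def)
  have v: "col (Inl v) = 13 + enumeration D v" if "v \<in> D" for v using that by (simp add: cv_def)
  have e: "col (Inr e) = 13 + card D + enumeration F e" if "e \<in> F" for e using that by (simp add: ce_def)
  show "inj_on col (Inl ` D \<union> Inr ` F)"
  proof (rule inj_on_disjoint_Un)
    show "inj_on col (Inl ` D)" "inj_on col (Inr ` F)"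
      using D(1) F by (intro inj_on_imageI inj_onI; simp only: o_apply v e add_left_cancel inj_on_eq_iff)+
    show "col ` Inl ` D \<subseteq> {..<13 + card D}"
      using v D(2) by (intro image_subsetI) (elim imageE; simp only: lessThan_iff add_less_cancel_left)
    show "col ` Inr ` F \<subseteq> {13 + card D..}"
      using e by (intro image_subsetI) (elim imageE; simp only: atLeast_iff le_add1)
    show "{..<13 + card D} \<inter> {13 + card D..} = {}" by auto
  qed
  have "13 \<le> col a" if "a \<in> Inl ` D \<union> Inr ` F" for a
    using that by (elim UnE imageE) (simp_all only: v e le_add1 add.assoc)
  then show "col ` (Inl ` D \<union> Inr ` F) \<subseteq> {13..}" by blast
qed

text \<open>Follow one route into the tree, cross the tree, and leave by the other route reversed.
  The three color blocks are disjoint.\<close>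

lemma joined_imp_path:
  assumes "joined x y"
  shows "\<exists>r. total_rainbow_path G cv ce r \<and> hd r = x \<and> last r = y"
proof -
  from assms obtain K p d K' q e where p: "route x K p d" and q: "route y K' q e"
    and K: "K \<inter> K' = {}" "K \<union> K' \<subseteq> {..<13}" and pq: "set p \<inter> set q = {}"
    unfolding joined_def by blast
  have "d \<in> D" "e \<in> D" using p q by (auto simp: route_def)
  then obtain t where t: "vpath t G" "hd t = d" "last t = e" "set t \<subseteq> D" "set (path_edges t) \<subseteq> F"
    using subtree_path[OF tree] by blast
  have "t \<noteq> []" using t(1) by (auto simp: vpath_def vwalk_def)
  define r where "r = p @ t @ rev q"
  \<comment> \<open>The tail \<open>t @ rev q\<close> is the reverse of \<open>q @ rev t\<close>, to
    which the join lemma applies.\<close>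
  have rev_q: "set (vwalk_arcs (t @ rev q))
      = set (vwalk_arcs t) \<union> {(v, u). (u, v) \<in> set (vwalk_arcs (q @ [e]))}"
  proof -
    have "set (vwalk_arcs (q @ rev t)) = set (vwalk_arcs (q @ [e])) \<union> set (vwalk_arcs (rev t))"
      using set_vwalk_arcs_join[of "rev t" q] \<open>t \<noteq> []\<close> t(3) by (simp add: hd_rev)
    moreover have "t @ rev q = rev (q @ rev t)" by simp
    ultimately show ?thesis unfolding \<open>t @ rev q = rev (q @ rev t)\<close> set_vwalk_arcs_rev[of "q @ rev t"]
      by (auto simp: set_vwalk_arcs_rev)
  qed
  have arcs: "set (vwalk_arcs r) = set (vwalk_arcs (p @ [d])) \<union> set (vwalk_arcs t)
      \<union> {(v, u). (u, v) \<in> set (vwalk_arcs (q @ [e]))}"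
    using set_vwalk_arcs_join[of "t @ rev q" p] \<open>t \<noteq> []\<close> t(2) rev_q by (simp add: r_def Un_assoc)
  then have edges: "set (path_edges r)
      = set (path_edges (p @ [d])) \<union> set (path_edges t) \<union> set (path_edges (q @ [e]))"
    by (force simp: path_edges_def image_iff)
  have pv: "set p \<subseteq> verts G" "set (vwalk_arcs (p @ [d])) \<subseteq> arcs_ends G" "distinct p" "set p \<inter> D = {}"
    and qv: "set q \<subseteq> verts G" "set (vwalk_arcs (q @ [e])) \<subseteq> arcs_ends G" "distinct q" "set q \<inter> D = {}"
    using p q by (simp_all add: route_def vpath_def vwalk_def)
  have tv: "set t \<subseteq> verts G" "set (vwalk_arcs t) \<subseteq> arcs_ends G" "distinct t"
    using t(1) by (simp_all add: vpath_def vwalk_def)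
  have "distinct r" using pv(3,4) qv(3,4) pq tv(3) t(4) unfolding r_def distinct_append by auto
  moreover have "set (vwalk_arcs r) \<subseteq> arcs_ends G"
    unfolding arcs using pv(2) qv(2) tv(2) by (auto intro: arcs_ends_sym)
  ultimately have "vpath r G"
    using pv(1) qv(1) tv(1) \<open>t \<noteq> []\<close> by (simp add: vpath_def vwalk_def r_def)
  let ?P = "Inl ` set (tl p) \<union> Inr ` set (path_edges (p @ [d]))"
  let ?Q = "Inl ` set (tl q) \<union> Inr ` set (path_edges (q @ [e]))"
  have P: "inj_on col ?P" "col ` ?P \<subseteq> K" and Q: "inj_on col ?Q" "col ` ?Q \<subseteq> K'"
    using p q by (simp_all add: route_def)
  have "inj_on col (?P \<union> ?Q)" by (rule inj_on_disjoint_Un[OF P(1) Q(1) P(2) Q(2) K(1)])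
  moreover have "A \<union> B \<subseteq> {..<13}" if "A \<subseteq> K" "B \<subseteq> K'" for A B using that K(2) by blast
  then have "col ` (?P \<union> ?Q) \<subseteq> {..<13}" unfolding image_Un[of col ?P ?Q] using P(2) Q(2) .
  ultimately have "inj_on col (?P \<union> ?Q \<union> (Inl ` D \<union> Inr ` F))"
    by (rule inj_on_disjoint_Un[OF _ inj_on_tree _ col_tree]) auto
  moreover have "Inl ` set (internal_verts r) \<union> Inr ` set (path_edges r)
      \<subseteq> ?P \<union> ?Q \<union> (Inl ` D \<union> Inr ` F)"
  proof -
    have "set (internal_verts r) \<subseteq> set (tl p) \<union> set (tl q) \<union> D"
      using set_internal_verts_append[OF \<open>t \<noteq> []\<close>, of p q] t(4) unfolding r_def by blast
    moreover have "set (path_edges r) \<subseteq> set (path_edges (p @ [d])) \<union> set (path_edges (q @ [e])) \<union> F"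
      using t(5) unfolding edges by blast
    ultimately show ?thesis by (rule image_Inl_Inr_Un)
  qed
  ultimately have "total_rainbow_path G cv ce r" using \<open>vpath r G\<close> by (intro total_rainbow_pathI)
  moreover have "hd r = x" using p t(2) \<open>t \<noteq> []\<close> by (cases p) (auto simp: r_def route_def)
  moreover have "last r = y" using q t(3) \<open>t \<noteq> []\<close>
    by (cases q) (auto simp: r_def route_def)
  ultimately show ?thesis by blast
qed

section \<open>Routes into the tree\<close>

lemma route_tree: "x \<in> D \<Longrightarrow> route x {} [] x"
  using tree_props(1) by (auto simp: route_def path_edges_def vpath_self)

lemma route_direct:
  assumes "x \<in> L" "d \<in> nbrs G x" "d \<in> D"
  shows "route x {ce {x, d}} [x] d"
  using assms L_not_D L_verts nbrs_subset_verts
  by (auto simp: route_def path_edges_def vpath_def vwalk_def nbrs_def)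

text \<open>The vertex, the link edge and the first edge take colors from the disjoint ranges 0 to
  3, 4 to 7 and 8 to 12. The range for the first edge covers starts in \<open>L\<close> and at
  distance two.\<close>

lemma route_step:
  assumes "x \<in> verts G" "x \<notin> D" "y \<in> L" "y \<in> nbrs G x" "ce {x, y} \<in> {8..12}"
  shows "route x {ce {x, y}, cl y, 4 + cl y} [x, y] (link y)"
proof -
  have "y \<noteq> x" using assms(4) not_in_nbrs by blast
  moreover have "cv y = cl y" using L_not_D[OF assms(3)] by (simp add: cv_def)
  moreover have "ce {x, y} \<noteq> ce {y, link y}" "ce {x, y} \<noteq> cl y"
    using assms(5) ce_link[OF assms(3)] cl_less[of y] by auto
  ultimately show ?thesis
    using assms L_not_D L_verts link[OF assms(3)] nbrs_subset_verts ce_link[OF assms(3)]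
    by (auto simp: route_def path_edges_def vpath_def vwalk_def nbrs_def inj_on_def)
qed

lemma route_near: "x \<in> L \<Longrightarrow> route x {4 + cl x} [x] (link x)"
  using route_direct[of x "link x"] link ce_link by simp

text \<open>A second way into the tree that avoids the class of \<open>x\<close>, for pairs in
  \<open>L\<close> of equal class.\<close>

lemma route_near_other:
  assumes "x \<in> L"
  shows "\<exists>c p d. c \<noteq> cl x \<and> c < 4 \<and> route x {12, c, 4 + c} p d
    \<and> (\<forall>z\<in>set p. z = x \<or> z \<in> L \<and> cl z = c)"
  using near_classes[OF assms]
proof (elim disjE bexE)
  fix z assume z: "z \<in> nbrs G x \<inter> L" "cl z \<noteq> cl x"
  then have "route x {12, cl z, 4 + cl z} [x, z] (link z)"
    using route_step[of x z] assms L_not_D L_verts ce_near[of x z] by auto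
  with z cl_less show ?thesis by (intro exI[of _ "cl z"] exI[of _ "[x, z]"] exI[of _ "link z"]) auto
next
  fix d d' assume d: "d \<in> nbrs G x \<inter> D" "d' \<in> nbrs G x \<inter> D" "d \<noteq> d'"
  then obtain f where f: "f \<in> nbrs G x" "f \<in> D" "f \<noteq> link x" by blast
  then have "route x {12} [x] f"
    using route_direct[of x f] assms ce_not_link[of x f] by simp
  \<comment> \<open>This entrance uses color 12 only; the color set is enlarged to match the other
    case.\<close>
  then have "route x {12, c, 4 + c} [x] f" for c by (auto simp: route_def)
  moreover obtain c where "c \<noteq> cl x" "c < (4 :: nat)"
    by (rule that[of "if cl x = 0 then 1 else 0"]) auto
  ultimately show ?thesis by (intro exI[of _ c] exI[of _ "[x]"] exI[of _ f]) auto
qed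

lemma route_far:
  assumes "x \<in> verts G" "x \<notin> closed_nbhd G D"
  shows "\<exists>y\<in>L. cl y \<noteq> c \<and> route x {8 + cl y, cl y, 4 + cl y} [x, y] (link y)"
proof -
  obtain y z where "y \<in> nbrs G x \<inter> L" "z \<in> nbrs G x \<inter> L" "cl y \<noteq> cl z"
    using far_classes[of x] assms by blast
  then have "\<exists>y\<in>nbrs G x \<inter> L. cl y \<noteq> c" by metis
  then obtain y where y: "y \<in> nbrs G x" "y \<in> L" "cl y \<noteq> c" by blast
  moreover have "x \<notin> D" using assms(2) by (simp add: closed_nbhd_def)
  ultimately show ?thesis
    using route_step[of x y] assms ce_far[of x y] cl_less[of y] by auto
qed

section \<open>Any two vertices are joined\<close>

lemma joinedI:
  assumes "route x K p d" "route y K' q e" "K \<inter> K' = {}" "K \<union> K' \<subseteq> {..<13}" "set p \<inter> set q = {}"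
  shows "joined x y"
  using assms unfolding joined_def by blast

lemma joined_tree:
  assumes "x \<in> D" "y \<in> verts G"
  shows "joined x y"
proof -
  consider "y \<in> D" | "y \<in> L" | "y \<notin> closed_nbhd G D" by (auto simp: L_def)
  then show ?thesis
  proof cases
    case 1
    show ?thesis by (rule joinedI[OF route_tree[OF assms(1)] route_tree[OF 1]]) auto
  next
    case 2
    show ?thesis
      by (rule joinedI[OF route_tree[OF assms(1)] route_near[OF 2]]) (use cl_less[of y] in auto)
  next
    case 3
    obtain z where "route y {8 + cl z, cl z, 4 + cl z} [y, z] (link z)"
      using route_far[OF assms(2) 3] by blast
    then show ?thesis
      by (rule joinedI[OF route_tree[OF assms(1)]]) (use cl_less[of z] in auto)
  qed
qed

text \<open>The link route of \<open>x\<close> uses only the color \<open>4 + cl x\<close>, so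
  \<open>y\<close> just needs a route that avoids the class of \<open>x\<close>.\<close>

lemma joined_near:
  assumes "x \<in> L" "y \<in> verts G" "x \<noteq> y" "y \<notin> D"
  shows "joined x y"
proof -
  consider "y \<in> L" "cl x = cl y" | "y \<in> L" "cl x \<noteq> cl y" | "y \<notin> closed_nbhd G D"
    using assms(4) by (auto simp: L_def)
  then show ?thesis
  proof cases
    case 1
    obtain c p d where c: "c \<noteq> cl y" "c < 4" "route y {12, c, 4 + c} p d"
      "\<forall>z\<in>set p. z = y \<or> z \<in> L \<and> cl z = c"
      using route_near_other[OF 1(1)] by blast
    show ?thesis
      \<comment> \<open>The vertex \<open>x\<close> is not on the detour, whose vertices other than
        \<open>y\<close> have class \<open>c\<close>.\<close>
      by (rule joinedI[OF route_near[OF assms(1)] c(3)]) (use c 1 assms(3) cl_less[of y] in auto)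
  next
    case 2
    show ?thesis
      by (rule joinedI[OF route_near[OF assms(1)] route_near[OF 2(1)]])
        (use 2 assms(3) cl_less[of x] cl_less[of y] in auto)
  next
    case 3
    obtain z where z: "cl z \<noteq> cl x" "route y {8 + cl z, cl z, 4 + cl z} [y, z] (link z)"
      using route_far[OF assms(2) 3] by blast
    show ?thesis
      by (rule joinedI[OF route_near[OF assms(1)] z(2)])
        (use z assms(3) cl_less[of x] cl_less[of z] in auto)
  qed
qed

lemma joined_far:
  assumes "x \<in> verts G" "x \<notin> closed_nbhd G D" "y \<in> verts G" "y \<notin> closed_nbhd G D" "x \<noteq> y"
  shows "joined x y"
proof -
  obtain v where v: "v \<in> L" "route x {8 + cl v, cl v, 4 + cl v} [x, v] (link v)"
    using route_far[OF assms(1,2)] by blast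
  \<comment> \<open>The second vertex sees two classes, so it can avoid the class used by the
    first.\<close>
  obtain w where w: "w \<in> L" "cl w \<noteq> cl v" "route y {8 + cl w, cl w, 4 + cl w} [y, w] (link w)"
    using route_far[OF assms(3,4)] by blast
  have "x \<noteq> w" "y \<noteq> v" using assms v(1) w(1) L_nbhd by auto
  then show ?thesis
    by (intro joinedI[OF v(2) w(3)]) (use w(2) assms(5) cl_less[of v] cl_less[of w] in auto)
qed

lemma total_rainbow_connected: "total_rainbow_connected G cv ce"
  unfolding total_rainbow_connected_def
proof (intro ballI)
  fix x y assume xy: "x \<in> verts G" "y \<in> verts G"
  show "\<exists>p. total_rainbow_path G cv ce p \<and> hd p = x \<and> last p = y"
  proof (cases "x = y")
    case True
    with xy show ?thesis
      by (intro exI[of _ "[x]"])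
        (simp add: total_rainbow_path_def vpath_self path_edges_def internal_verts_def)
  next
    case False
    have "joined x y"
    proof (cases "x \<in> D \<or> y \<in> D")
      case True
      with xy joined_tree joined_sym show ?thesis by blast
    next
      case notD: False
      show ?thesis
      proof (cases "x \<in> L \<or> y \<in> L")
        case True
        with xy False notD joined_near[of x y] joined_near[of y x] joined_sym show ?thesis by blast
      next
        case False
        with xy \<open>x \<noteq> y\<close> notD joined_far show ?thesis by (auto simp: L_def)
      qed
    qed
    then show ?thesis by (rule joined_imp_path)
  qed
qed

text \<open>Thirteen colors outside the tree, plus \<open>card D\<close> for its vertices and
  \<open>card D - 1\<close> for its edges.\<close>

lemma num_colors_le: "num_colors G cv ce \<le> 12 + 2 * card D"
proof -
  have D: "enumeration D v < card D" if "v \<in> D" for v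
    using bij_betw_enumeration[OF finite_D] that by (auto simp: bij_betw_def)
  have F: "enumeration F e < card F" if "e \<in> F" for e
    using bij_betw_enumeration[OF tree_props(3)] that by (auto simp: bij_betw_def)
  have "cv v < 13 + card D + card F" for v
    using D[of v] cl_less[of v] by (auto simp: cv_def)
  moreover have "ce e < 13 + card D + card F" for e
    using F[of e] cl_less[of "the_elem (e \<inter> L)"] by (auto simp: ce_def)
  ultimately have "cv ` verts G \<union> ce ` undirected_edges G \<subseteq> {..<13 + card D + card F}" by auto
  then have "card (cv ` verts G \<union> ce ` undirected_edges G) \<le> card {..<13 + card D + card F}"
    by (intro card_mono) auto
  then show ?thesis using tree_props(4) by (simp add: num_colors_def)
qed

end

section \<open>The numerical bounds\<close>

lemma trc_le:
  assumes "graph G" "Digraph_Component.connected G" "2 \<le> min_degree G"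
  shows "real (trc G) \<le> 6 * real (card (verts G)) / (real (min_degree G) + 1) + 12"
proof -
  interpret graph G by fact
  let ?\<delta> = "min_degree G"
  have deg: "?\<delta> \<le> card (nbrs G v)" if "v \<in> verts G" for v
    unfolding card_nbrs min_degree_def using that by (intro Min_le) auto
  obtain D F where DF: "subtree G D F" "Suc ?\<delta> * card D \<le> 3 * card (verts G)"
    and far: "\<And>u. u \<in> verts G - closed_nbhd G D \<Longrightarrow>
      Suc ?\<delta> < 3 * card (nbrs G u \<inter> (closed_nbhd G D - D))"
    and near: "\<And>y. y \<in> closed_nbhd G D - D \<Longrightarrow> 3 * card (nbrs G y - closed_nbhd G D) \<le> ?\<delta>"
    using ex_dominating_subtree[OF assms(2) deg] by metis
  obtain cl :: "'a \<Rightarrow> nat" where cl: "\<And>v. cl v < 4"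
    "\<And>u. u \<in> verts G - closed_nbhd G D \<Longrightarrow> \<exists>y\<in>nbrs G u \<inter> (closed_nbhd G D - D).
      \<exists>z\<in>nbrs G u \<inter> (closed_nbhd G D - D). cl y \<noteq> cl z"
    "\<And>y. y \<in> closed_nbhd G D - D \<Longrightarrow> (\<exists>z\<in>nbrs G y \<inter> (closed_nbhd G D - D). cl z \<noteq> cl y)
      \<or> (\<exists>d\<in>nbrs G y \<inter> D. \<exists>d'\<in>nbrs G y \<inter> D. d \<noteq> d')"
    using ex_classes[OF subtree_props(1)[OF DF(1)] assms(3) deg far near] by metis
  interpret classified_subtree G D F cl "closed_nbhd G D - D"
    using DF(1) cl by unfold_locales auto
  have "trc G \<le> num_colors G cv ce"
    unfolding trc_def using total_rainbow_connected by (intro Least_le) blast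
  also have "\<dots> \<le> 12 + 2 * card D" by (rule num_colors_le)
  finally have "real (trc G) \<le> 12 + 2 * real (card D)" by linarith
  moreover have "real (Suc ?\<delta> * card D) \<le> real (3 * card (verts G))"
    using DF(2) by (simp only: of_nat_le_iff)
  then have "real (card D) \<le> 3 * real (card (verts G)) / (real ?\<delta> + 1)"
    by (simp add: field_simps)
  ultimately show ?thesis by simp
qed

text \<open>Makes the third bound follow from 6n/(\<delta> + 1) + 12. It suffices that the exponent
  is at least \<open>ln 2\<close>.\<close>

lemma C_bound_nonneg:
  assumes "6 \<le> \<delta>" "\<delta> \<le> 15"
  shows "0 \<le> C_bound \<delta>"
proof -
  let ?p = "real \<delta> ^ 3 + 2 * real \<delta> ^ 2 + 3"
  have "6 ^ 3 \<le> real \<delta> ^ 3" using assms(1) by (intro power_mono) auto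
  \<comment> \<open>Since 48 is 3 times 2 to the fourth, the numerator is at least
    \<open>12 * ln 2\<close>, and 12 is the largest value of \<delta> - 3.\<close>
  then have "48 \<le> ?p" by (simp add: add_increasing2)
  then have "ln 48 \<le> ln ?p" by (intro ln_mono) auto
  moreover have "ln (48 :: real) = ln 3 + 4 * ln 2"
    using ln_mult[of 3 "2 ^ 4 :: real"] ln_realpow[of 2 4] by simp
  ultimately have "12 * ln 2 \<le> 3 * ln ?p - 3 * (ln 3 - 1)" by simp
  moreover have "ln 2 * (real \<delta> - 3) \<le> ln 2 * 12" using assms(2) by (intro mult_left_mono) auto
  ultimately have "ln 2 * (real \<delta> - 3) \<le> 3 * ln ?p - 3 * (ln 3 - 1)" by linarith
  then have "ln 2 \<le> (3 * ln ?p - 3 * (ln 3 - 1)) / (real \<delta> - 3)"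
    using assms(1) by (simp add: pos_le_divide_eq)
  then have "exp (ln 2) \<le> exp ((3 * ln ?p - 3 * (ln 3 - 1)) / (real \<delta> - 3))"
    by (simp only: exp_le_cancel_iff)
  then show ?thesis by (simp add: C_bound_def)
qed

theorem theorem5:
  fixes G :: "('a, 'b) pre_digraph" and n \<delta> :: nat
  assumes "graph G"
    and "Digraph_Component.connected G"
    and "n = card (verts G)"
    and "\<delta> = min_degree G"
  shows "(real \<delta> \<ge> sqrt (real n - 2) - 1 \<and> n \<ge> 291
            \<longrightarrow> real (trc G) \<le> 6 * real n / (real \<delta> + 1) + 28)
       \<and> (16 \<le> \<delta> \<and> real \<delta> \<le> sqrt (real n - 2) - 2
            \<longrightarrow> real (trc G) \<le> 7 * real n / (real \<delta> + 1) + 32)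
       \<and> (6 \<le> \<delta> \<and> \<delta> \<le> 15
            \<longrightarrow> real (trc G) \<le> 7 * real n / (real \<delta> + 1) + 4 * C_bound \<delta> + 12)"
proof -
  have bound: "real (trc G) \<le> 6 * real n / (real \<delta> + 1) + 12" if "2 \<le> \<delta>"
    using trc_le[of G] assms that by simp
  have "6 * real n / (real \<delta> + 1) \<le> 7 * real n / (real \<delta> + 1)"
    by (intro divide_right_mono) auto
  moreover have "2 \<le> \<delta>" if "real \<delta> \<ge> sqrt (real n - 2) - 1" "n \<ge> 291"
  proof -
    \<comment> \<open>In the first case the lower bound on \<open>n\<close> is what forces \<delta>
      to be at least 2.\<close>
    have "3 \<le> sqrt (real n - 2)" using that(2) by (intro real_le_rsqrt) simp
    with that(1) show ?thesis by simp
  qed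
  ultimately show ?thesis using bound C_bound_nonneg[of \<delta>] by auto
qed

end
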